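(* Let $A$ be a finite nonempty set and let $(A,\rho)$ be a poset with least and greatest element (where $\rho\subseteq A^2$ is the order relation). The following are equivalent: (A) $\rho$ is a lattice order; (B) $\mathrm{gQuord}\,\mathrm{Pol}\,\rho=\mathrm{Inv}\,\mathrm{Pol}\,\rho$; (C) $[\rho]_{(\land,=)}=[\rho]_{(\exists,\land,=)}$.
   Context: All operations $f:A^n\to A$ and relations $\sigma\subseteq A^m$ have finite arity $n,m\ge 1$. An operation $f:A^n\to A$ preserves $\sigma\subseteq A^m$ if applying $f$ componentwise to any $r_1,\dots,r_n\in\sigma$ gives a tuple in $\sigma$. $\mathrm{Pol}\,\rho$ is the set of all finitary operations on $A$ preserving $\rho$. For a set $F$ of operations, $\mathrm{Inv}\,F$ is the set of all nonempty relations on $A$ (of all arities) preserved by every $f\in F$. A relation $\sigma\subseteq A^m$ is reflexive if $(a,\dots,a)\in\sigma$ for all $a\in A$; it is (generalized) transitive if for every matrix $(a_{ij})\in A^{m\times m}$ all of whose rows and all of whose columns belong to $\sigma$, the diagonal $(a_{11},\dots,a_{mm})$ belongs to $\sigma$. A generalized quasiorder is a reflexive and transitive relation $\sigma\subseteq A^m$ for some $m\ge1$. $\mathrm{gQuord}\,F$ is the set of all generalized quasiorders belonging to $\mathrm{Inv}\,F$. $[\rho]_{(\exists,\land,=)}$ is the set of all relations $\{(a_1,\dots,a_m)\in A^m\mid \varphi(a_1,\dots,a_m)\}$, $m\ge1$, definable by a primitive positive formula $\varphi(x_1,\dots,x_m)$, i.e. an existentially quantified finite conjunction of atomic formulas $(z,z')\in\rho$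 or $z=z'$ ($z,z'$ variables). $[\rho]_{(\land,=)}$ is the set of those definable by such formulas without quantifiers. *)

theory Defs
  imports "HOL-Library.FuncSet" "HOL-Algebra.Lattice"
begin

text \<open>
  Tuples are lists, and the coordinates \<open>1, \<dots>, m\<close> of the informal text are \<open>0, \<dots>, m - 1\<close> here.
  Operations and relations are paired with their arity, so that every element of a set of
  operations or relations carries a definite arity (an empty relation would not determine it).
\<close>

definition tuples :: "'a set \<Rightarrow> nat \<Rightarrow> 'a list set" where
  "tuples A n = {xs. length xs = n \<and> set xs \<subseteq> A}"

text \<open>Extensional function spaces make two operations equal iff they agree on \<open>A\<^sup>n\<close>.\<close>

definition operations :: "'a set \<Rightarrow> (nat \<times> ('a list \<Rightarrow> 'a)) set" where
  "operations A = {(n, f). 1 \<le> n \<and> f \<in> tuples A n \<rightarrow>\<^sub>E A}"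

definition relations :: "'a set \<Rightarrow> (nat \<times> 'a list set) set" where
  "relations A = {(m, \<sigma>). 1 \<le> m \<and> \<sigma> \<subseteq> tuples A m}"

fun preserves :: "nat \<times> ('a list \<Rightarrow> 'a) \<Rightarrow> nat \<times> 'a list set \<Rightarrow> bool" where
  "preserves (n, f) (m, \<sigma>) \<longleftrightarrow>
     (\<forall>rs. length rs = n \<and> set rs \<subseteq> \<sigma> \<longrightarrow> map (\<lambda>i. f (map (\<lambda>r. r ! i) rs)) [0..<m] \<in> \<sigma>)"

definition binary_rel :: "('a \<times> 'a) set \<Rightarrow> nat \<times> 'a list set" where
  "binary_rel \<rho> = (2, {[x, y] | x y. (x, y) \<in> \<rho>})"

definition Pol :: "'a set \<Rightarrow> nat \<times> 'a list set \<Rightarrow> (nat \<times> ('a list \<Rightarrow> 'a)) set" where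
  "Pol A R = {g \<in> operations A. preserves g R}"

definition Inv :: "'a set \<Rightarrow> (nat \<times> ('a list \<Rightarrow> 'a)) set \<Rightarrow> (nat \<times> 'a list set) set" where
  "Inv A F = {R \<in> relations A. snd R \<noteq> {} \<and> (\<forall>g\<in>F. preserves g R)}"

definition gen_reflexive :: "'a set \<Rightarrow> nat \<Rightarrow> 'a list set \<Rightarrow> bool" where
  "gen_reflexive A m \<sigma> \<longleftrightarrow> (\<forall>a\<in>A. replicate m a \<in> \<sigma>)"

definition gen_transitive :: "'a set \<Rightarrow> nat \<Rightarrow> 'a list set \<Rightarrow> bool" where
  "gen_transitive A m \<sigma> \<longleftrightarrow>
     (\<forall>M :: nat \<Rightarrow> nat \<Rightarrow> 'a.
        (\<forall>i<m. \<forall>j<m. M i j \<in> A) \<and>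
        (\<forall>i<m. map (\<lambda>j. M i j) [0..<m] \<in> \<sigma>) \<and>
        (\<forall>j<m. map (\<lambda>i. M i j) [0..<m] \<in> \<sigma>) \<longrightarrow>
        map (\<lambda>i. M i i) [0..<m] \<in> \<sigma>)"

definition gen_quasiorder :: "'a set \<Rightarrow> nat \<times> 'a list set \<Rightarrow> bool" where
  "gen_quasiorder A R \<longleftrightarrow>
     R \<in> relations A \<and> gen_reflexive A (fst R) (snd R) \<and> gen_transitive A (fst R) (snd R)"

definition gQuord :: "'a set \<Rightarrow> (nat \<times> ('a list \<Rightarrow> 'a)) set \<Rightarrow> (nat \<times> 'a list set) set" where
  "gQuord A F = {R \<in> Inv A F. gen_quasiorder A R}"

text \<open>
  Atomic formulas over variables numbered by natural numbers: \<open>Rel_atom i j\<close> stands for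
  \<open>(z\<^sub>i, z\<^sub>j) \<in> \<rho>\<close> and \<open>Eq_atom i j\<close> for \<open>z\<^sub>i = z\<^sub>j\<close>.
\<close>

datatype atom = Rel_atom nat nat | Eq_atom nat nat

fun atom_vars :: "atom \<Rightarrow> nat set" where
  "atom_vars (Rel_atom i j) = {i, j}"
| "atom_vars (Eq_atom i j) = {i, j}"

fun atom_holds :: "('a \<times> 'a) set \<Rightarrow> 'a list \<Rightarrow> atom \<Rightarrow> bool" where
  "atom_holds \<rho> zs (Rel_atom i j) \<longleftrightarrow> (zs ! i, zs ! j) \<in> \<rho>"
| "atom_holds \<rho> zs (Eq_atom i j) \<longleftrightarrow> zs ! i = zs ! j"

text \<open>
  The relation defined by the primitive positive formula with free variables \<open>z\<^sub>0, \<dots>, z\<^sub>m\<^sub>-\<^sub>1\<close>,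
  existentially quantified variables \<open>z\<^sub>m, \<dots>, z\<^sub>m\<^sub>+\<^sub>k\<^sub>-\<^sub>1\<close> and the conjunction of the
  atoms in the list \<open>\<phi>\<close> as matrix. The case \<open>k = 0\<close> is that of a quantifier-free formula.
\<close>

definition pp_defined ::
  "'a set \<Rightarrow> ('a \<times> 'a) set \<Rightarrow> nat \<Rightarrow> nat \<Rightarrow> atom list \<Rightarrow> 'a list set" where
  "pp_defined A \<rho> m k \<phi> =
     {xs \<in> tuples A m. \<exists>ys\<in>tuples A k. \<forall>\<alpha>\<in>set \<phi>. atom_holds \<rho> (xs @ ys) \<alpha>}"

definition pp_closure :: "'a set \<Rightarrow> ('a \<times> 'a) set \<Rightarrow> (nat \<times> 'a list set) set" where
  "pp_closure A \<rho> =
     {(m, pp_defined A \<rho> m k \<phi>) | m k \<phi>. 1 \<le> m \<and> (\<forall>\<alpha>\<in>set \<phi>. atom_vars \<alpha> \<subseteq> {..<m + k})}"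

definition qf_closure :: "'a set \<Rightarrow> ('a \<times> 'a) set \<Rightarrow> (nat \<times> 'a list set) set" where
  "qf_closure A \<rho> =
     {(m, pp_defined A \<rho> m 0 \<phi>) | m \<phi>. 1 \<le> m \<and> (\<forall>\<alpha>\<in>set \<phi>. atom_vars \<alpha> \<subseteq> {..<m})}"

definition lattice_order_on :: "'a set \<Rightarrow> ('a \<times> 'a) set \<Rightarrow> bool" where
  "lattice_order_on A \<rho> \<longleftrightarrow>
     lattice \<lparr>carrier = A, eq = (=), le = (\<lambda>x y. (x, y) \<in> \<rho>)\<rparr>"

end

theory Submission
  imports Defs
begin

text \<open>
  If \<open>\<rho>\<close> is a lattice order, an invariant relation \<open>\<sigma>\<close> contains every tuple \<open>v\<close> satisfying all
  inequalities \<open>x\<^sub>i \<le> x\<^sub>j\<close> that hold throughout some nonempty finite list of members of \<open>\<sigma>\<close>: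
  writing \<open>p\<^sub>i\<close> for the list of their \<open>i\<close>-th entries, the operation
  \<open>x \<mapsto> \<Squnion>{v\<^sub>i | p\<^sub>i \<le> x}\<close> is monotone and maps \<open>p\<^sub>i\<close> to \<open>v\<^sub>i\<close>. Taking for the list the rows and
  columns of a matrix \<open>M\<close> gives transitivity, because \<open>M\<^sub>i\<^sub>i \<le> M\<^sub>i\<^sub>j \<le> M\<^sub>j\<^sub>j\<close>; taking all of \<open>\<sigma>\<close> gives a
  quantifier-free definition of \<open>\<sigma>\<close>.

  Conversely, let \<open>\<sigma>\<close> be the relation \<open>\<exists>u. x, y \<le> u \<le> z, w\<close>. The only nontrivial atoms valid on
  \<open>\<sigma>\<close> are \<open>x, y \<le> z, w\<close>. If these inequalities hold, then \<open>(x, y, z, w)\<close> is the diagonal of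
  the matrix with rows \<open>(x, 0, z, w)\<close>, \<open>(0, y, z, w)\<close>, \<open>(x, y, z, 1)\<close>, \<open>(x, y, 1, w)\<close>, whose rows and
  columns lie in \<open>\<sigma>\<close>. So both (B) and (C) yield an interpolant \<open>u\<close> whenever \<open>x, y \<le> z, w\<close>, and
  for a finite bounded poset this makes a minimal upper bound of \<open>x\<close> and \<open>y\<close> the least one.
\<close>

lemma tuples_nth: "xs \<in> tuples B n \<Longrightarrow> i < n \<Longrightarrow> xs ! i \<in> B"
  by (auto simp: tuples_def)

lemma upt_0_2: "[0..<2] = [0, 1]"
  by (simp add: numeral_2_eq_2)

section \<open>Finite bounded posets: joins and interpolation\<close>

locale bounded_finite_poset =
  fixes A :: "'a set" and \<rho> :: "('a \<times> 'a) set" and b t :: 'a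
  assumes fin: "finite A"
    and po: "partial_order_on A \<rho>"
    and bA: "b \<in> A" and tA: "t \<in> A"
    and bot: "\<And>x. x \<in> A \<Longrightarrow> (b, x) \<in> \<rho>"
    and top: "\<And>x. x \<in> A \<Longrightarrow> (x, t) \<in> \<rho>"
begin

lemma rel_refl: "x \<in> A \<Longrightarrow> (x, x) \<in> \<rho>"
  using po by (auto simp: partial_order_on_def preorder_on_def refl_on_def)

lemma rel_trans: "(x, y) \<in> \<rho> \<Longrightarrow> (y, z) \<in> \<rho> \<Longrightarrow> (x, z) \<in> \<rho>"
  using po by (auto simp: partial_order_on_def preorder_on_def dest: transD)

lemma rel_antisym: "(x, y) \<in> \<rho> \<Longrightarrow> (y, x) \<in> \<rho> \<Longrightarrow> x = y"
  using po by (auto simp: partial_order_on_def dest: antisymD)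

lemma rel_mem: "(x, y) \<in> \<rho> \<Longrightarrow> x \<in> A \<and> y \<in> A"
  using po by (auto simp: partial_order_on_def preorder_on_def refl_on_def)

definition has_joins :: bool where
  "has_joins \<longleftrightarrow> (\<forall>x\<in>A. \<forall>y\<in>A. \<exists>s\<in>A. (x, s) \<in> \<rho> \<and> (y, s) \<in> \<rho> \<and>
     (\<forall>z\<in>A. (x, z) \<in> \<rho> \<and> (y, z) \<in> \<rho> \<longrightarrow> (s, z) \<in> \<rho>))"

text \<open>This is the Riesz interpolation property for two lower and two upper elements.\<close>

definition interpolates :: bool where
  "interpolates \<longleftrightarrow> (\<forall>x\<in>A. \<forall>y\<in>A. \<forall>z\<in>A. \<forall>w\<in>A.
     (x, z) \<in> \<rho> \<and> (x, w) \<in> \<rho> \<and> (y, z) \<in> \<rho> \<and> (y, w) \<in> \<rho> \<longrightarrow>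
     (\<exists>u\<in>A. (x, u) \<in> \<rho> \<and> (y, u) \<in> \<rho> \<and> (u, z) \<in> \<rho> \<and> (u, w) \<in> \<rho>))"

text \<open>Order duality: with \<open>b\<close> and \<open>t\<close> exchanged, every result on
  joins can be reused for meets.\<close>

lemma converse_bounded_finite_poset: "bounded_finite_poset A (\<rho>\<inverse>) t b"
  using fin po bA tA bot top by unfold_locales auto

lemma has_joins_if_interpolates:
  assumes interpolates
  shows has_joins
  unfolding has_joins_def
proof (intro ballI)
  fix x y assume xy: "x \<in> A" "y \<in> A"
  define U where "U = {u \<in> A. (x, u) \<in> \<rho> \<and> (y, u) \<in> \<rho>}"
  have U: "finite U" "t \<in> U" using fin xy tA top by (auto simp: U_def)
  \<comment> \<open>The strict order on a finite set is acyclic, hence well-founded; so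
    \<open>U\<close>, which contains \<open>t\<close>, has a minimal element
    \<open>s\<close>.\<close>
  have "wf (Restr (\<rho> - Id) A)"
  proof (rule finite_acyclic_wf)
    show "finite (Restr (\<rho> - Id) A)" using fin by (auto intro: finite_subset[of _ "A \<times> A"])
    have "(Restr (\<rho> - Id) A)\<^sup>+ \<subseteq> \<rho> - Id"
    proof
      fix p assume "p \<in> (Restr (\<rho> - Id) A)\<^sup>+"
      then obtain v w where p: "p = (v, w)" "(v, w) \<in> (Restr (\<rho> - Id) A)\<^sup>+" by (cases p) auto
      from p(2) have "(v, w) \<in> \<rho> - Id"
        by induction (use rel_trans rel_antisym in \<open>blast+\<close>)
      thus "p \<in> \<rho> - Id" using p by simp
    qed
    thus "acyclic (Restr (\<rho> - Id) A)" by (auto simp: acyclic_def)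
  qed
  from wfE_min[OF this U(2)] obtain s where
    s: "s \<in> U" "\<And>v. (v, s) \<in> Restr (\<rho> - Id) A \<Longrightarrow> v \<notin> U" by metis
  have "(s, z) \<in> \<rho>" if z: "z \<in> U" for z
  proof -
    \<comment> \<open>Here \<open>u\<close> interpolates between \<open>x\<close>, \<open>y\<close>
      below and \<open>s\<close>, \<open>z\<close> above. It is again an upper bound, so minimality
      of \<open>s\<close> forces \<open>u = s\<close>.\<close>
    obtain u where "u \<in> U" "(u, s) \<in> \<rho>" "(u, z) \<in> \<rho>"
      using assms s(1) z xy unfolding interpolates_def U_def by blast
    moreover from this have "u = s" using s rel_mem by blast
    ultimately show ?thesis by simp
  qed
  thus "\<exists>s\<in>A. (x, s) \<in> \<rho> \<and> (y, s) \<in> \<rho> \<and> (\<forall>z\<in>A. (x, z) \<in> \<rho> \<and> (y, z) \<in> \<rho> \<longrightarrow> (s, z) \<in> \<rho>)"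
    using s(1) unfolding U_def by blast
qed

text \<open>Binary joins are iterated, starting from \<open>b\<close> as the join of the empty set.
  The empty case does matter: the monotone operation built below may have no value to dominate at
  some arguments.\<close>

lemma has_joins_finite:
  assumes has_joins and "S \<subseteq> A"
  shows "\<exists>s\<in>A. (\<forall>x\<in>S. (x, s) \<in> \<rho>) \<and> (\<forall>z\<in>A. (\<forall>x\<in>S. (x, z) \<in> \<rho>) \<longrightarrow> (s, z) \<in> \<rho>)"
proof -
  have "finite S" using assms(2) fin by (rule finite_subset)
  thus ?thesis using assms(2)
  proof induction
    case empty
    show ?case using bA bot by blast
  next
    case (insert x S)
    then obtain s where s: "s \<in> A" "\<forall>x\<in>S. (x, s) \<in> \<rho>"
        "\<forall>z\<in>A. (\<forall>x\<in>S. (x, z) \<in> \<rho>) \<longrightarrow> (s, z) \<in> \<rho>"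
      by auto
    moreover obtain r where "r \<in> A" "(x, r) \<in> \<rho>" "(s, r) \<in> \<rho>"
        "\<forall>z\<in>A. (x, z) \<in> \<rho> \<and> (s, z) \<in> \<rho> \<longrightarrow> (r, z) \<in> \<rho>"
      using assms(1) insert.prems s(1) unfolding has_joins_def by blast
    ultimately show ?case by (intro bexI[of _ r]) (use rel_trans in \<open>blast+\<close>)
  qed
qed

section \<open>Joins, meets and lattice orders\<close>

lemma has_joins_if_lattice:
  assumes "lattice_order_on A \<rho>"
  shows has_joins
proof -
  interpret lattice "\<lparr>carrier = A, eq = (=), le = (\<lambda>x y. (x, y) \<in> \<rho>)\<rparr>"
    using assms by (simp add: lattice_order_on_def)
  show ?thesis
    unfolding has_joins_def
  proof (intro ballI)
    fix x y assume "x \<in> A" "y \<in> A"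
    with sup_of_two_exists[of x y] obtain s where
      "least \<lparr>carrier = A, eq = (=), le = (\<lambda>x y. (x, y) \<in> \<rho>)\<rparr> s
         (Upper \<lparr>carrier = A, eq = (=), le = (\<lambda>x y. (x, y) \<in> \<rho>)\<rparr> {x, y})" by auto
    thus "\<exists>s\<in>A. (x, s) \<in> \<rho> \<and> (y, s) \<in> \<rho> \<and>
        (\<forall>z\<in>A. (x, z) \<in> \<rho> \<and> (y, z) \<in> \<rho> \<longrightarrow> (s, z) \<in> \<rho>)"
      using \<open>x \<in> A\<close> \<open>y \<in> A\<close> by (intro bexI[of _ s]) (auto simp: least_def Upper_def)
  qed
qed

lemma lattice_if_joins_meets:
  assumes joins: has_joins
    and meets: "\<And>x y. x \<in> A \<Longrightarrow> y \<in> A \<Longrightarrow> \<exists>s\<in>A. (s, x) \<in> \<rho> \<and> (s, y) \<in> \<rho> \<and>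
      (\<forall>z\<in>A. (z, x) \<in> \<rho> \<and> (z, y) \<in> \<rho> \<longrightarrow> (z, s) \<in> \<rho>)"
  shows "lattice_order_on A \<rho>"
proof -
  let ?L = "\<lparr>carrier = A, eq = (=), le = (\<lambda>x y. (x, y) \<in> \<rho>)\<rparr>"
  have "partial_order ?L"
  proof unfold_locales
    fix x y z assume "x \<sqsubseteq>\<^bsub>?L\<^esub> y" "y \<sqsubseteq>\<^bsub>?L\<^esub> z"
    thus "x \<sqsubseteq>\<^bsub>?L\<^esub> z" by simp (rule rel_trans)
  qed (auto dest: rel_antisym simp: rel_refl)
  then interpret partial_order ?L .
  show ?thesis unfolding lattice_order_on_def
  proof unfold_locales
    fix x y assume "x \<in> carrier ?L" "y \<in> carrier ?L"
    hence xy: "x \<in> A" "y \<in> A" by auto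
    obtain s where "s \<in> A" "(x, s) \<in> \<rho>" "(y, s) \<in> \<rho>"
        "\<forall>z\<in>A. (x, z) \<in> \<rho> \<and> (y, z) \<in> \<rho> \<longrightarrow> (s, z) \<in> \<rho>"
      using joins xy unfolding has_joins_def by blast
    thus "\<exists>s. least ?L s (Upper ?L {x, y})"
      using xy by (intro exI[of _ s]) (auto simp: least_def Upper_def)
    obtain s where "s \<in> A" "(s, x) \<in> \<rho>" "(s, y) \<in> \<rho>"
        "\<forall>z\<in>A. (z, x) \<in> \<rho> \<and> (z, y) \<in> \<rho> \<longrightarrow> (z, s) \<in> \<rho>"
      using meets[OF xy] by blast
    thus "\<exists>s. greatest ?L s (Lower ?L {x, y})"
      using xy by (intro exI[of _ s]) (auto simp: greatest_def Lower_def)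
  qed
qed

text \<open>Interpolation is self-dual: reversing the order merely exchanges the lower pair with the
  upper pair. Joins in the converse order are the required meets.\<close>

lemma lattice_if_interpolates:
  assumes interpolates
  shows "lattice_order_on A \<rho>"
proof (rule lattice_if_joins_meets)
  show has_joins by (rule has_joins_if_interpolates[OF assms])
  note dual = converse_bounded_finite_poset
  have "bounded_finite_poset.interpolates A (\<rho>\<inverse>)"
    unfolding bounded_finite_poset.interpolates_def[OF dual]
  proof (intro ballI impI)
    fix x y z w
    assume A: "x \<in> A" "y \<in> A" "z \<in> A" "w \<in> A"
      and "(x, z) \<in> \<rho>\<inverse> \<and> (x, w) \<in> \<rho>\<inverse> \<and> (y, z) \<in> \<rho>\<inverse> \<and> (y, w) \<in> \<rho>\<inverse>"
    then obtain u where "u \<in> A" "(z, u) \<in> \<rho>" "(w, u) \<in> \<rho>" "(u, x) \<in> \<rho>" "(u, y) \<in> \<rho>"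
      using assms[unfolded interpolates_def, rule_format, of z w x y] by auto
    thus "\<exists>u\<in>A. (x, u) \<in> \<rho>\<inverse> \<and> (y, u) \<in> \<rho>\<inverse> \<and> (u, z) \<in> \<rho>\<inverse> \<and> (u, w) \<in> \<rho>\<inverse>"
      by blast
  qed
  hence "bounded_finite_poset.has_joins A (\<rho>\<inverse>)"
    by (rule bounded_finite_poset.has_joins_if_interpolates[OF dual])
  thus "\<exists>s\<in>A. (s, x) \<in> \<rho> \<and> (s, y) \<in> \<rho> \<and> (\<forall>z\<in>A. (z, x) \<in> \<rho> \<and> (z, y) \<in> \<rho> \<longrightarrow> (z, s) \<in> \<rho>)"
    if "x \<in> A" "y \<in> A" for x y
    using that unfolding bounded_finite_poset.has_joins_def[OF dual] by simp
qed

section \<open>Monotone operations with prescribed values\<close>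

lemma Pol_apply:
  assumes "(n, f) \<in> Pol A (binary_rel \<rho>)" and "length rs = n" and "set rs \<subseteq> \<rho>"
  shows "(f (map fst rs), f (map snd rs)) \<in> \<rho>"
proof -
  define qs where "qs = map (\<lambda>r. [fst r, snd r]) rs"
  have "preserves (n, f) (2, {[x, y] | x y. (x, y) \<in> \<rho>})"
    using assms(1) by (simp add: Pol_def binary_rel_def)
  moreover have "length qs = n \<and> set qs \<subseteq> {[x, y] | x y. (x, y) \<in> \<rho>}"
    using assms(2,3) by (auto simp: qs_def)
  ultimately have "map (\<lambda>i. f (map (\<lambda>r. r ! i) qs)) [0..<2] \<in> {[x, y] | x y. (x, y) \<in> \<rho>}"
    unfolding preserves.simps by blast
  thus ?thesis by (simp add: upt_0_2 qs_def comp_def)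
qed

text \<open>Common source of transitivity and quantifier elimination: by \<open>mono\<close>, the
  prescription of the value \<open>v ! i\<close> at the column of \<open>i\<close>-th entries of
  \<open>rs\<close> respects the order, and joins extend it to a polymorphism. Applying this to
  \<open>rs\<close> yields \<open>v\<close>. Equal columns need no separate condition, by
  antisymmetry.\<close>

lemma Pol_closed_determined:
  assumes has_joins
    and inv: "\<And>g. g \<in> Pol A (binary_rel \<rho>) \<Longrightarrow> preserves g (m, \<sigma>)"
    and \<sigma>: "\<sigma> \<subseteq> tuples A m"
    and rs: "set rs \<subseteq> \<sigma>" "rs \<noteq> []"
    and v: "v \<in> tuples A m"
    and mono: "\<And>i j. i < m \<Longrightarrow> j < m \<Longrightarrow> \<forall>r\<in>set rs. (r ! i, r ! j) \<in> \<rho> \<Longrightarrow> (v ! i, v ! j) \<in> \<rho>"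
  shows "v \<in> \<sigma>"
proof -
  define n where "n = length rs"
  \<comment> \<open>The prescribed values that monotonicity forces below the value at
    \<open>xs\<close>; their join \<open>s xs\<close> is the least possible choice.\<close>
  define S where "S xs = {v ! i | i. i < m \<and> (\<forall>k<n. (rs ! k ! i, xs ! k) \<in> \<rho>)}" for xs
  have SA: "S xs \<subseteq> A" for xs using v by (auto simp: S_def tuples_nth)
  have "\<forall>xs. \<exists>s\<in>A. (\<forall>x\<in>S xs. (x, s) \<in> \<rho>) \<and> (\<forall>z\<in>A. (\<forall>x\<in>S xs. (x, z) \<in> \<rho>) \<longrightarrow> (s, z) \<in> \<rho>)"
    by (intro allI has_joins_finite[OF assms(1) SA])
  from choice[OF this[unfolded Bex_def]] obtain s where s: "\<And>xs. s xs \<in> A" "\<And>xs x. x \<in> S xs \<Longrightarrow> (x, s xs) \<in> \<rho>"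
      "\<And>xs z. z \<in> A \<Longrightarrow> (\<And>x. x \<in> S xs \<Longrightarrow> (x, z) \<in> \<rho>) \<Longrightarrow> (s xs, z) \<in> \<rho>"
    by blast
  define f where "f = restrict s (tuples A n)"
  have "(n, f) \<in> operations A"
    using rs(2) s(1) by (auto simp: operations_def f_def n_def Suc_le_eq)
  moreover have "preserves (n, f) (binary_rel \<rho>)"
    unfolding binary_rel_def preserves.simps
  proof (intro allI impI)
    fix qs assume qs: "length qs = n \<and> set qs \<subseteq> {[x, y] | x y. (x, y) \<in> \<rho>}"
    let ?xs = "map (\<lambda>r. r ! 0) qs" and ?ys = "map (\<lambda>r. r ! 1) qs"
    have le: "(?xs ! k, ?ys ! k) \<in> \<rho>" if "k < n" for k
    proof -
      have "qs ! k \<in> set qs" using qs that by simp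
      with qs have "qs ! k \<in> {[x, y] | x y. (x, y) \<in> \<rho>}" by blast
      thus ?thesis using qs that by auto
    qed
    \<comment> \<open>Monotonicity: a column below \<open>?xs\<close> is also below
      \<open>?ys\<close>, so \<open>S\<close> grows with its argument and so does its join.\<close>
    have "(rs ! k ! i, ?ys ! k) \<in> \<rho>" if "k < n" "(rs ! k ! i, ?xs ! k) \<in> \<rho>" for k i
      using that(2) le[OF that(1)] by (rule rel_trans)
    hence "S ?xs \<subseteq> S ?ys" unfolding S_def by blast
    hence "(s ?xs, s ?ys) \<in> \<rho>" by (intro s(3)[OF s(1)], intro s(2), rule subsetD)
    moreover have "?xs \<in> tuples A n" "?ys \<in> tuples A n"
      using qs le[THEN rel_mem] by (auto simp: tuples_def set_conv_nth)
    ultimately show "map (\<lambda>i. f (map (\<lambda>r. r ! i) qs)) [0..<2] \<in> {[x, y] | x y. (x, y) \<in> \<rho>}"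
      by (simp add: upt_0_2 f_def)
  qed
  ultimately have "preserves (n, f) (m, \<sigma>)" by (intro inv) (simp add: Pol_def)
  hence "map (\<lambda>i. f (map (\<lambda>r. r ! i) rs)) [0..<m] \<in> \<sigma>" using rs by (simp add: n_def)
  moreover have "map (\<lambda>i. f (map (\<lambda>r. r ! i) rs)) [0..<m] = v"
  proof (rule nth_equalityI)
    show "length (map (\<lambda>i. f (map (\<lambda>r. r ! i) rs)) [0..<m]) = length v"
      using v by (simp add: tuples_def)
  next
    fix i assume "i < length (map (\<lambda>i. f (map (\<lambda>r. r ! i) rs)) [0..<m])"
    hence i: "i < m" by simp
    let ?p = "map (\<lambda>r. r ! i) rs"
    have mem: "r ! i \<in> A" if "r \<in> set rs" for r using that rs \<sigma> i tuples_nth by blast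
    \<comment> \<open>By reflexivity \<open>v ! i\<close> belongs to \<open>S ?p\<close>, and by
      \<open>mono\<close> it bounds all of \<open>S ?p\<close>. Hence the join is exactly
      \<open>v ! i\<close>.\<close>
    have "\<forall>k<n. (rs ! k ! i, ?p ! k) \<in> \<rho>" using mem by (simp add: n_def rel_refl)
    hence "v ! i \<in> S ?p" unfolding S_def using i by blast
    hence "(v ! i, s ?p) \<in> \<rho>" by (rule s)
    moreover have "(x, v ! i) \<in> \<rho>" if "x \<in> S ?p" for x
    proof -
      from that obtain j where j: "x = v ! j" "j < m" "\<forall>k<n. (rs ! k ! j, ?p ! k) \<in> \<rho>"
        unfolding S_def by blast
      have "\<forall>r\<in>set rs. (r ! j, r ! i) \<in> \<rho>"
        using j(3) by (simp add: n_def all_set_conv_all_nth)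
      thus ?thesis unfolding j(1) by (rule mono[OF j(2) i])
    qed
    hence "(s ?p, v ! i) \<in> \<rho>" using v i by (intro s(3)) (auto simp: tuples_nth)
    ultimately have "s ?p = v ! i" by (rule rel_antisym[symmetric])
    moreover have "?p \<in> tuples A n" using mem by (auto simp: tuples_def n_def)
    ultimately show "map (\<lambda>i. f (map (\<lambda>r. r ! i) rs)) [0..<m] ! i = v ! i"
      using i by (simp add: f_def)
  qed
  ultimately show ?thesis by simp
qed

section \<open>Primitive positive definable relations\<close>

lemma pp_defined_subset: "pp_defined A \<rho> m k \<phi> \<subseteq> tuples A m"
  by (auto simp: pp_defined_def)

text \<open>A witness \<open>w r\<close> is chosen for each tuple \<open>r\<close>. Applying
  \<open>f\<close> coordinatewise to these witnesses gives a witness for the image tuple, since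
  \<open>f\<close> preserves each atom.\<close>

lemma pp_defined_preserved:
  assumes g: "g \<in> Pol A (binary_rel \<rho>)" and \<phi>: "\<forall>\<alpha>\<in>set \<phi>. atom_vars \<alpha> \<subseteq> {..<m + k}"
  shows "preserves g (m, pp_defined A \<rho> m k \<phi>)"
proof -
  obtain n f where gnf: "g = (n, f)" by (cases g)
  have f: "f xs \<in> A" if "xs \<in> tuples A n" for xs
    using g gnf that by (auto simp: Pol_def operations_def)
  show ?thesis
    unfolding gnf preserves.simps
  proof (intro allI impI)
    fix rs assume rs: "length rs = n \<and> set rs \<subseteq> pp_defined A \<rho> m k \<phi>"
    hence "\<forall>r\<in>set rs. \<exists>w. w \<in> tuples A k \<and> (\<forall>\<alpha>\<in>set \<phi>. atom_holds \<rho> (r @ w) \<alpha>)"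
      by (auto simp: pp_defined_def)
    then obtain w where w: "\<And>r. r \<in> set rs \<Longrightarrow> w r \<in> tuples A k"
        "\<And>r \<alpha>. r \<in> set rs \<Longrightarrow> \<alpha> \<in> set \<phi> \<Longrightarrow> atom_holds \<rho> (r @ w r) \<alpha>"
      by metis
    have r: "r \<in> tuples A m" if "r \<in> set rs" for r
      using rs that pp_defined_subset by blast
    let ?xs = "map (\<lambda>i. f (map (\<lambda>r. r ! i) rs)) [0..<m]"
    let ?ys = "map (\<lambda>i. f (map (\<lambda>r. w r ! i) rs)) [0..<k]"
    have xs: "?xs \<in> tuples A m"
      using rs r by (force simp: tuples_def intro!: f)
    have ys: "?ys \<in> tuples A k"
      using rs w(1) by (force simp: tuples_def intro!: f)
    have nth: "(?xs @ ?ys) ! i = f (map (\<lambda>r. (r @ w r) ! i) rs)" if "i < m + k" for i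
    proof -
      have "length r = m" if "r \<in> set rs" for r using r[OF that] by (simp add: tuples_def)
      thus ?thesis using that by (auto simp: nth_append intro!: arg_cong[of _ _ f])
    qed
    have "atom_holds \<rho> (?xs @ ?ys) \<alpha>" if \<alpha>: "\<alpha> \<in> set \<phi>" for \<alpha>
    proof (cases \<alpha>)
      case (Rel_atom i j)
      let ?qs = "map (\<lambda>r. ((r @ w r) ! i, (r @ w r) ! j)) rs"
      have "set ?qs \<subseteq> \<rho>" using w(2)[OF _ \<alpha>] Rel_atom by auto
      hence "(f (map fst ?qs), f (map snd ?qs)) \<in> \<rho>"
        using g rs unfolding gnf by (intro Pol_apply) auto
      moreover have "i < m + k" "j < m + k" using \<phi> \<alpha> Rel_atom by force+
      ultimately show ?thesis using Rel_atom by (simp add: nth comp_def)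
    next
      case (Eq_atom i j)
      have "i < m + k" "j < m + k" using \<phi> \<alpha> Eq_atom by force+
      moreover have "map (\<lambda>r. (r @ w r) ! i) rs = map (\<lambda>r. (r @ w r) ! j) rs"
        using w(2)[OF _ \<alpha>] Eq_atom by auto
      hence "f (map (\<lambda>r. (r @ w r) ! i) rs) = f (map (\<lambda>r. (r @ w r) ! j) rs)"
        by (rule arg_cong)
      ultimately show ?thesis using Eq_atom by (simp add: nth)
    qed
    thus "?xs \<in> pp_defined A \<rho> m k \<phi>"
      unfolding pp_defined_def using xs ys by blast
  qed
qed

text \<open>All atoms hold when every variable, quantified or free, takes the value
  \<open>a\<close>. This supplies the nonemptiness demanded by \<open>Inv\<close> and by
  \<open>Pol_closed_determined\<close>.\<close>

lemma replicate_in_pp_defined: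
  assumes "a \<in> A" and \<phi>: "\<forall>\<alpha>\<in>set \<phi>. atom_vars \<alpha> \<subseteq> {..<m + k}"
  shows "replicate m a \<in> pp_defined A \<rho> m k \<phi>"
proof -
  have "atom_holds \<rho> (replicate m a @ replicate k a) \<alpha>" if "\<alpha> \<in> set \<phi>" for \<alpha>
    using \<phi> that assms(1) rel_refl by (cases \<alpha>) (force simp: replicate_add[symmetric])+
  thus ?thesis using assms(1)
    by (auto simp: pp_defined_def tuples_def intro!: exI bexI[of _ "replicate k a"])
qed

section \<open>Consequences of joins: generalized quasiorders and quantifier elimination\<close>

lemma gen_reflexive_if_invariant:
  assumes "(m, \<sigma>) \<in> Inv A (Pol A (binary_rel \<rho>))"
  shows "gen_reflexive A m \<sigma>"
  unfolding gen_reflexive_def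
proof
  fix a assume a: "a \<in> A"
  \<comment> \<open>The constant unary operation is a polymorphism because \<rho> is reflexive; it
    sends any member of the nonempty \<sigma> to the constant tuple.\<close>
  let ?f = "restrict (\<lambda>_. a) (tuples A 1)"
  have "preserves (1, ?f) (binary_rel \<rho>)"
    unfolding binary_rel_def preserves.simps
  proof (intro allI impI)
    fix qs assume "length qs = 1 \<and> set qs \<subseteq> {[x, y] | x y. (x, y) \<in> \<rho>}"
    then obtain x y where "qs = [[x, y]]" "(x, y) \<in> \<rho>" by (auto simp: length_Suc_conv)
    thus "map (\<lambda>i. ?f (map (\<lambda>r. r ! i) qs)) [0..<2] \<in> {[x, y] | x y. (x, y) \<in> \<rho>}"
      using rel_refl[OF a] rel_mem[of x y] by (simp add: upt_0_2 tuples_def)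
  qed
  hence "(1, ?f) \<in> Pol A (binary_rel \<rho>)"
    using a by (auto simp: Pol_def operations_def)
  hence "preserves (1, ?f) (m, \<sigma>)" using assms unfolding Inv_def by blast
  moreover obtain r where r: "r \<in> \<sigma>" "r \<in> tuples A m"
    using assms by (auto simp: Inv_def relations_def)
  ultimately have "map (\<lambda>i. ?f (map (\<lambda>r. r ! i) [r])) [0..<m] \<in> \<sigma>"
    unfolding preserves.simps by (metis One_nat_def empty_set empty_subsetI insert_subset length_Cons list.set(2) list.size(3))
  moreover have "map (\<lambda>i. ?f (map (\<lambda>r. r ! i) [r])) [0..<m] = replicate m a"
    using r(2) tuples_nth[OF r(2)] by (auto simp: list_eq_iff_nth_eq tuples_def)
  ultimately show "replicate m a \<in> \<sigma>" by simp
qed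

lemma gen_transitive_if_invariant:
  assumes has_joins and "(m, \<sigma>) \<in> Inv A (Pol A (binary_rel \<rho>))"
  shows "gen_transitive A m \<sigma>"
  unfolding gen_transitive_def
proof (intro allI impI)
  fix M :: "nat \<Rightarrow> nat \<Rightarrow> 'a"
  assume M: "(\<forall>i<m. \<forall>j<m. M i j \<in> A) \<and>
        (\<forall>i<m. map (\<lambda>j. M i j) [0..<m] \<in> \<sigma>) \<and>
        (\<forall>j<m. map (\<lambda>i. M i j) [0..<m] \<in> \<sigma>)"
  let ?rows = "map (\<lambda>i. map (\<lambda>j. M i j) [0..<m]) [0..<m]"
  let ?cols = "map (\<lambda>j. map (\<lambda>i. M i j) [0..<m]) [0..<m]"
  have m: "1 \<le> m" and \<sigma>: "\<sigma> \<subseteq> tuples A m"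
    using assms(2) by (auto simp: Inv_def relations_def)
  show "map (\<lambda>i. M i i) [0..<m] \<in> \<sigma>"
  proof (rule Pol_closed_determined[OF assms(1) _ \<sigma>, where rs = "?rows @ ?cols"])
    show "preserves g (m, \<sigma>)" if "g \<in> Pol A (binary_rel \<rho>)" for g
      using that assms(2) by (simp add: Inv_def)
    show "set (?rows @ ?cols) \<subseteq> \<sigma>" using M by auto
    show "?rows @ ?cols \<noteq> []" using m by simp
    show "map (\<lambda>i. M i i) [0..<m] \<in> tuples A m" using M by (auto simp: tuples_def)
    fix i j assume ij: "i < m" "j < m" and le: "\<forall>r\<in>set (?rows @ ?cols). (r ! i, r ! j) \<in> \<rho>"
    \<comment> \<open>Row \<open>i\<close> compares \<open>M i i\<close> with \<open>M i j\<close>,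
      and column \<open>j\<close> compares \<open>M i j\<close> with \<open>M j j\<close>.\<close>
    have "map (\<lambda>j. M i j) [0..<m] \<in> set (?rows @ ?cols)"
         "map (\<lambda>i. M i j) [0..<m] \<in> set (?rows @ ?cols)"
      using ij by auto
    hence "(M i i, M i j) \<in> \<rho>" "(M i j, M j j) \<in> \<rho>" using le ij by fastforce+
    thus "(map (\<lambda>i. M i i) [0..<m] ! i, map (\<lambda>i. M i i) [0..<m] ! j) \<in> \<rho>"
      using ij rel_trans by simp
  qed
qed

lemma gQuord_eq_Inv_if_has_joins:
  assumes has_joins
  shows "gQuord A (Pol A (binary_rel \<rho>)) = Inv A (Pol A (binary_rel \<rho>))"
proof -
  have "gen_quasiorder A R" if "R \<in> Inv A (Pol A (binary_rel \<rho>))" for R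
    using that gen_reflexive_if_invariant gen_transitive_if_invariant[OF assms]
    by (cases R) (simp add: gen_quasiorder_def Inv_def)
  thus ?thesis by (auto simp: gQuord_def)
qed

lemma qf_closure_eq_pp_closure_if_has_joins:
  assumes has_joins
  shows "qf_closure A \<rho> = pp_closure A \<rho>"
proof
  show "qf_closure A \<rho> \<subseteq> pp_closure A \<rho>"
    unfolding qf_closure_def pp_closure_def by force
  show "pp_closure A \<rho> \<subseteq> qf_closure A \<rho>"
  proof
    fix R assume "R \<in> pp_closure A \<rho>"
    then obtain m k \<phi> where R: "R = (m, pp_defined A \<rho> m k \<phi>)" and m: "1 \<le> m"
      and \<phi>: "\<forall>\<alpha>\<in>set \<phi>. atom_vars \<alpha> \<subseteq> {..<m + k}"
      unfolding pp_closure_def by auto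
    define \<sigma> where "\<sigma> = pp_defined A \<rho> m k \<phi>"
    have "finite (tuples A m)" unfolding tuples_def
      using finite_lists_length_eq[OF fin, of m] by (simp add: conj_commute)
    hence "finite \<sigma>" using pp_defined_subset unfolding \<sigma>_def by (rule rev_finite_subset)
    then obtain rs where rs: "set rs = \<sigma>" using finite_list by blast
    \<comment> \<open>The conjunction of all order atoms valid on \<sigma>. A valid equality is
      captured by two opposite order atoms.\<close>
    define \<psi> where "\<psi> = [Rel_atom i j. i \<leftarrow> [0..<m], j \<leftarrow> [0..<m], \<forall>r\<in>\<sigma>. (r ! i, r ! j) \<in> \<rho>]"
    have \<psi>: "set \<psi> = {Rel_atom i j | i j. i < m \<and> j < m \<and> (\<forall>r\<in>\<sigma>. (r ! i, r ! j) \<in> \<rho>)}"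
      unfolding \<psi>_def by auto
    have "pp_defined A \<rho> m 0 \<psi> = \<sigma>"
    proof
      show "\<sigma> \<subseteq> pp_defined A \<rho> m 0 \<psi>"
        using pp_defined_subset[of m k \<phi>] by (auto simp: pp_defined_def \<psi> \<sigma>_def tuples_def)
      show "pp_defined A \<rho> m 0 \<psi> \<subseteq> \<sigma>"
      proof
        fix v assume v: "v \<in> pp_defined A \<rho> m 0 \<psi>"
        show "v \<in> \<sigma>"
        proof (rule Pol_closed_determined[OF assms])
          show "preserves g (m, \<sigma>)" if "g \<in> Pol A (binary_rel \<rho>)" for g
            unfolding \<sigma>_def using that \<phi> by (rule pp_defined_preserved)
          show "\<sigma> \<subseteq> tuples A m" unfolding \<sigma>_def by (rule pp_defined_subset)
          show "set rs \<subseteq> \<sigma>" by (simp add: rs)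
          show "rs \<noteq> []" using rs replicate_in_pp_defined[OF bA \<phi>] unfolding \<sigma>_def by auto
          show "v \<in> tuples A m" using v pp_defined_subset by blast
          fix i j assume "i < m" "j < m" "\<forall>r\<in>set rs. (r ! i, r ! j) \<in> \<rho>"
          hence "Rel_atom i j \<in> set \<psi>" using rs \<psi> by simp
          thus "(v ! i, v ! j) \<in> \<rho>" using v by (auto simp: pp_defined_def tuples_def)
        qed
      qed
    qed
    moreover have "\<forall>\<alpha>\<in>set \<psi>. atom_vars \<alpha> \<subseteq> {..<m}" using \<psi> by auto
    ultimately show "R \<in> qf_closure A \<rho>"
      using m unfolding qf_closure_def R \<sigma>_def by blast
  qed
qed

section \<open>The interpolant relation and the converse directions\<close>

definition interpolant_formula :: "atom list" where
  "interpolant_formula = [Rel_atom 0 4, Rel_atom 1 4, Rel_atom 4 2, Rel_atom 4 3]"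

lemma interpolant_formula_vars: "\<forall>\<alpha>\<in>set interpolant_formula. atom_vars \<alpha> \<subseteq> {..<4 + 1}"
  by (auto simp: interpolant_formula_def)

text \<open>Variable 4 of the formula is the quantified \<open>u\<close>. Membership of the elements
  in \<open>A\<close> stays implicit, because \<rho> relates only members of
  \<open>A\<close>.\<close>

lemma in_interpolant_iff:
  "[x, y, z, w] \<in> pp_defined A \<rho> 4 1 interpolant_formula \<longleftrightarrow>
     (\<exists>u. (x, u) \<in> \<rho> \<and> (y, u) \<in> \<rho> \<and> (u, z) \<in> \<rho> \<and> (u, w) \<in> \<rho>)"
proof -
  have "(\<exists>ys\<in>tuples A 1. P ys) \<longleftrightarrow> (\<exists>u\<in>A. P [u])" for P
    by (auto simp: tuples_def length_Suc_conv)
  thus ?thesis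
    by (auto simp: pp_defined_def interpolant_formula_def tuples_def dest: rel_mem)
qed

lemma interpolates_if_gQuord_eq_Inv:
  assumes "gQuord A (Pol A (binary_rel \<rho>)) = Inv A (Pol A (binary_rel \<rho>))"
  shows interpolates
  unfolding interpolates_def
proof (intro ballI impI)
  fix x y z w assume A: "x \<in> A" "y \<in> A" "z \<in> A" "w \<in> A"
    and le: "(x, z) \<in> \<rho> \<and> (x, w) \<in> \<rho> \<and> (y, z) \<in> \<rho> \<and> (y, w) \<in> \<rho>"
  let ?\<sigma> = "pp_defined A \<rho> 4 1 interpolant_formula"
  have "(4, ?\<sigma>) \<in> Inv A (Pol A (binary_rel \<rho>))"
    using pp_defined_preserved[OF _ interpolant_formula_vars] pp_defined_subset
      replicate_in_pp_defined[OF bA interpolant_formula_vars]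
    by (auto simp: Inv_def relations_def)
  hence "(4, ?\<sigma>) \<in> gQuord A (Pol A (binary_rel \<rho>))" by (simp only: assms)
  hence trans: "gen_transitive A 4 ?\<sigma>" by (simp add: gQuord_def gen_quasiorder_def)
  define M where "M i j = [[x, b, z, w], [b, y, z, w], [x, y, z, t], [x, y, t, w]] ! i ! j"
    for i j :: nat
  have lt4: "(\<forall>i<4. P i) \<longleftrightarrow> P 0 \<and> P 1 \<and> P 2 \<and> P 3" for P :: "nat \<Rightarrow> bool"
    by (auto simp: numeral_eq_Suc less_Suc_eq)
  have upt: "[0..<4] = [0, 1, 2, 3]" by (simp add: numeral_eq_Suc)
  \<comment> \<open>The interpolants are \<open>x\<close>, \<open>y\<close>, \<open>z\<close>,
    \<open>w\<close> in this order, and the same elements serve for the columns. For the rows the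
    assumed inequalities are used; each \<open>b\<close> or \<open>t\<close> removes a constraint
    that the chosen interpolant could fail.\<close>
  have rows: "[x, b, z, w] \<in> ?\<sigma>" "[b, y, z, w] \<in> ?\<sigma>" "[x, y, z, t] \<in> ?\<sigma>" "[x, y, t, w] \<in> ?\<sigma>"
    unfolding in_interpolant_iff
    using le A[THEN rel_refl] A[THEN bot] A[THEN top] by blast+
  have cols: "[x, b, x, x] \<in> ?\<sigma>" "[b, y, y, y] \<in> ?\<sigma>" "[z, z, z, t] \<in> ?\<sigma>" "[w, w, t, w] \<in> ?\<sigma>"
    unfolding in_interpolant_iff
    using A[THEN rel_refl] A[THEN bot] A[THEN top] by blast+
  have "(\<forall>i<4. \<forall>j<4. M i j \<in> A) \<and> (\<forall>i<4. map (\<lambda>j. M i j) [0..<4] \<in> ?\<sigma>) \<and>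
    (\<forall>j<4. map (\<lambda>i. M i j) [0..<4] \<in> ?\<sigma>)"
  proof (intro conjI)
    show "\<forall>i<4. \<forall>j<4. M i j \<in> A" using A bA tA by (simp add: lt4 M_def)
    show "\<forall>i<4. map (\<lambda>j. M i j) [0..<4] \<in> ?\<sigma>"
      using rows by (simp add: lt4 upt M_def)
    show "\<forall>j<4. map (\<lambda>i. M i j) [0..<4] \<in> ?\<sigma>"
      using cols by (simp add: lt4 upt M_def)
  qed
  hence "map (\<lambda>i. M i i) [0..<4] \<in> ?\<sigma>" using trans unfolding gen_transitive_def by blast
  hence "[x, y, z, w] \<in> ?\<sigma>" by (simp add: upt M_def)
  thus "\<exists>u\<in>A. (x, u) \<in> \<rho> \<and> (y, u) \<in> \<rho> \<and> (u, z) \<in> \<rho> \<and> (u, w) \<in> \<rho>"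
    using in_interpolant_iff rel_mem by blast
qed

lemma interpolates_if_qf_closure_eq_pp_closure:
  assumes "qf_closure A \<rho> = pp_closure A \<rho>"
  shows interpolates
  unfolding interpolates_def
proof (intro ballI impI)
  fix x y z w assume A: "x \<in> A" "y \<in> A" "z \<in> A" "w \<in> A"
    and le: "(x, z) \<in> \<rho> \<and> (x, w) \<in> \<rho> \<and> (y, z) \<in> \<rho> \<and> (y, w) \<in> \<rho>"
  let ?\<sigma> = "pp_defined A \<rho> 4 1 interpolant_formula"
  show "\<exists>u\<in>A. (x, u) \<in> \<rho> \<and> (y, u) \<in> \<rho> \<and> (u, z) \<in> \<rho> \<and> (u, w) \<in> \<rho>"
  \<comment> \<open>The test tuples below consist of \<open>b\<close> and \<open>t\<close> and
    refute atoms only if these differ. If they coincide, the poset has one element.\<close>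
  proof (cases "b = t")
    case True
    hence "u = b" if "u \<in> A" for u using that bot top rel_antisym by metis
    thus ?thesis using A rel_refl by blast
  next
    case False
    hence not_le: "(t, b) \<notin> \<rho>" using bot[OF tA] rel_antisym by blast
    have "(4, ?\<sigma>) \<in> pp_closure A \<rho>"
      unfolding pp_closure_def using interpolant_formula_vars by force
    then obtain \<psi> where \<psi>: "?\<sigma> = pp_defined A \<rho> 4 0 \<psi>" "\<forall>\<alpha>\<in>set \<psi>. atom_vars \<alpha> \<subseteq> {..<4}"
      using assms unfolding qf_closure_def by blast
    \<comment> \<open>Each tuple has \<open>b\<close> or \<open>t\<close> as interpolant. The first
      two refute order atoms between variables 0 and 1, the next two those between 2 and 3, and the
      last one those placing 2 or 3 below 0 or 1. They also refute every equality of distinct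
      variables, so only atoms true at \<open>[x, y, z, w]\<close> remain in \<psi>.\<close>
    have "[t, b, t, t] \<in> ?\<sigma>" "[b, t, t, t] \<in> ?\<sigma>" "[b, b, t, b] \<in> ?\<sigma>" "[b, b, b, t] \<in> ?\<sigma>"
      "[b, b, t, t] \<in> ?\<sigma>"
      unfolding in_interpolant_iff using rel_refl[OF bA] rel_refl[OF tA] bot[OF tA] by blast+
    hence ex: "atom_holds \<rho> [t, b, t, t] \<alpha>" "atom_holds \<rho> [b, t, t, t] \<alpha>"
      "atom_holds \<rho> [b, b, t, b] \<alpha>" "atom_holds \<rho> [b, b, b, t] \<alpha>"
      "atom_holds \<rho> [b, b, t, t] \<alpha>" if "\<alpha> \<in> set \<psi>" for \<alpha>
      using that unfolding \<psi>(1) by (auto simp: pp_defined_def tuples_def)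
    have lt4: "i = 0 \<or> i = 1 \<or> i = 2 \<or> i = 3" if "i < 4" for i :: nat using that by auto
    have "atom_holds \<rho> [x, y, z, w] \<alpha>" if \<alpha>: "\<alpha> \<in> set \<psi>" for \<alpha>
    proof (cases \<alpha>)
      case (Rel_atom i j)
      hence "i < 4" "j < 4" using \<psi>(2) \<alpha> by force+
      from lt4[OF this(1)] lt4[OF this(2)] show ?thesis
        using ex[OF \<alpha>] not_le le A unfolding Rel_atom by (elim disjE) (simp_all add: rel_refl)
    next
      case (Eq_atom i j)
      hence "i < 4" "j < 4" using \<psi>(2) \<alpha> by force+
      from lt4[OF this(1)] lt4[OF this(2)] show ?thesis
        using ex[OF \<alpha>] False unfolding Eq_atom by (elim disjE) simp_all
    qed
    hence "[x, y, z, w] \<in> ?\<sigma>" unfolding \<psi>(1) using A by (auto simp: pp_defined_def tuples_def)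
    thus ?thesis using in_interpolant_iff rel_mem by blast
  qed
qed

end

theorem theorem5p3:
  fixes A :: "'a set" and \<rho> :: "('a \<times> 'a) set"
  assumes "finite A" and "A \<noteq> {}"
    and "partial_order_on A \<rho>"
    and "\<exists>b\<in>A. \<forall>x\<in>A. (b, x) \<in> \<rho>"
    and "\<exists>t\<in>A. \<forall>x\<in>A. (x, t) \<in> \<rho>"
  shows "(lattice_order_on A \<rho> \<longleftrightarrow>
            gQuord A (Pol A (binary_rel \<rho>)) = Inv A (Pol A (binary_rel \<rho>))) \<and>
         (gQuord A (Pol A (binary_rel \<rho>)) = Inv A (Pol A (binary_rel \<rho>)) \<longleftrightarrow>
            qf_closure A \<rho> = pp_closure A \<rho>)"
proof -
  obtain b t where "bounded_finite_poset A \<rho> b t"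
    using assms by (auto simp: bounded_finite_poset_def)
  then interpret bounded_finite_poset A \<rho> b t .
  show ?thesis
    using has_joins_if_lattice lattice_if_interpolates gQuord_eq_Inv_if_has_joins
      qf_closure_eq_pp_closure_if_has_joins interpolates_if_gQuord_eq_Inv
      interpolates_if_qf_closure_eq_pp_closure
    by blast
qed

end
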